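(* Let $B_1,\ldots,B_m$ be nonzero symmetric positive semidefinite $n\times n$ real matrices with $\sum_{i=1}^m B_i=I$, let $\gamma>0$, and let $\delta_U,\delta_L>0$ satisfy $$\frac{1}{\delta_L}-n\ \ge\ \frac{1}{\delta_U}.$$ Then for any symmetric positive definite $n\times n$ matrices $X_L,X_U$ of trace one, there exist $\alpha\in\mathbb{R}_+$ and $j\in\{1,\ldots,m\}$ such that $$\delta_U\ \ge\ \frac{\exp(\gamma\alpha\,\mathrm{tr}\,B_j)-1}{\mathrm{tr}\,B_j}\,\langle X_U,B_j\rangle\quad\text{and}\quad \delta_L\ \le\ \frac{1-\exp(-\gamma\alpha\,\mathrm{tr}\,B_j)}{\mathrm{tr}\,B_j}\,\langle X_L,B_j\rangle.$$
   Context: $\langle X,Y\rangle=\mathrm{tr}(XY)$ is the trace inner product; $\mathbb{R}_+$ denotes the nonnegative reals. *)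

theory Defs
  imports "HOL-Analysis.Analysis"
begin

definition symmetric_mat :: "real^'n^'n \<Rightarrow> bool" where
  "symmetric_mat A \<longleftrightarrow> transpose A = A"

definition sym_psd :: "real^'n^'n \<Rightarrow> bool" where
  "sym_psd A \<longleftrightarrow> symmetric_mat A \<and> (\<forall>x. 0 \<le> x \<bullet> (A *v x))"

definition sym_pd :: "real^'n^'n \<Rightarrow> bool" where
  "sym_pd A \<longleftrightarrow> symmetric_mat A \<and> (\<forall>x. x \<noteq> 0 \<longrightarrow> 0 < x \<bullet> (A *v x))"

definition trace_inner :: "real^'n^'n \<Rightarrow> real^'n^'n \<Rightarrow> real" where
  "trace_inner X Y = trace (X ** Y)"

end

theory Submission
  imports Defs
begin

text \<open>
  Write \<open>t\<close>, \<open>u\<close>, \<open>l\<close> for the trace of \<open>B j\<close> and its inner products with \<open>X\<^sub>U\<close> and \<open>X\<^sub>L\<close>. The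
  choice \<open>exp (\<gamma> \<alpha> t) = 1 + \<delta>\<^sub>U t / u\<close> makes the upper condition an equality and turns the lower
  one into \<open>u / \<delta>\<^sub>U + t \<le> l / \<delta>\<^sub>L\<close>. Summed over \<open>j\<close>, this becomes \<open>1 / \<delta>\<^sub>U + n \<le> 1 / \<delta>\<^sub>L\<close>, so it
  holds for some \<open>j\<close>. Positivity of \<open>t\<close> and \<open>u\<close> comes from splitting a positive semidefinite matrix
  into rank-one terms by symmetric Gaussian elimination.
\<close>

lemma symmetric_mat_iff: "symmetric_mat A \<longleftrightarrow> (\<forall>i j. A $ i $ j = A $ j $ i)"
  by (auto simp add: symmetric_mat_def vec_eq_iff transpose_def)

lemma inner_symmetric_mat:
  fixes A :: "real^'n^'n"
  assumes "symmetric_mat A"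
  shows "x \<bullet> (A *v y) = (A *v x) \<bullet> y"
  using assms by (metis dot_lmul_matrix symmetric_mat_def transpose_matrix_vector)

lemma matrix_vector_mult_axis_nth:
  fixes A :: "real^'n^'n"
  shows "(A *v axis i 1) $ j = A $ j $ i"
  by (simp add: matrix_vector_mult_basis column_def)

text \<open>With \<open>c\<close> the column \<open>A *v axis i 1\<close>, the zero diagonal entry
  removes the quadratic term of the form along \<open>c + s *\<^sub>R axis i 1\<close>. What remains
  is affine in \<open>s\<close> with slope \<open>2 * (c \<bullet> c)\<close>, and it can stay
  nonnegative for all \<open>s\<close> only if \<open>c = 0\<close>.\<close>

lemma sym_psd_diag_zero:
  fixes A :: "real^'n^'n"
  assumes A: "sym_psd A" and z: "A $ i $ i = 0"
  shows "A *v axis i 1 = 0"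
proof (rule ccontr)
  define c where "c = A *v axis i 1"
  assume "A *v axis i 1 \<noteq> 0"
  then have cc: "c \<bullet> c > 0" by (simp add: c_def)
  have sym: "symmetric_mat A" using A by (simp add: sym_psd_def)
  have Aii: "axis i 1 \<bullet> c = 0"
    using z by (simp add: c_def inner_axis' matrix_vector_mult_axis_nth)
  have *: "0 \<le> c \<bullet> (A *v c) + 2 * s * (c \<bullet> c)" for s
  proof -
    have "0 \<le> (c + s *\<^sub>R axis i 1) \<bullet> (A *v (c + s *\<^sub>R axis i 1))"
      using A by (simp add: sym_psd_def)
    also have "\<dots> = c \<bullet> (A *v c) + s * (c \<bullet> c) + s * (axis i 1 \<bullet> (A *v c)) + s * (s * (axis i 1 \<bullet> c))"
      by (simp add: c_def[symmetric] matrix_vector_right_distrib matrix_vector_mult_scaleR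
          inner_add_left inner_add_right algebra_simps)
    also have "axis i 1 \<bullet> (A *v c) = c \<bullet> c"
      using inner_symmetric_mat[OF sym, of "axis i 1" c] by (simp add: c_def)
    finally show ?thesis using Aii by simp
  qed
  \<comment> \<open>This \<open>s\<close> is where the affine function takes the value
    \<open>- 2 * (c \<bullet> c)\<close>.\<close>
  have "0 \<le> - 2 * (c \<bullet> c)"
    using *[of "- (c \<bullet> (A *v c) + 2 * (c \<bullet> c)) / (2 * (c \<bullet> c))"] cc by (simp add: field_simps)
  then show False using cc by simp
qed

lemma sym_psd_diag_pos:
  fixes A :: "real^'n^'n"
  assumes "sym_psd A" "A $ i $ i \<noteq> 0"
  shows "A $ i $ i > 0"
proof -
  have "0 \<le> axis i 1 \<bullet> (A *v axis i 1)"
    using assms(1) unfolding sym_psd_def by blast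
  then show ?thesis
    using assms(2) by (simp add: inner_axis' matrix_vector_mult_axis_nth)
qed

lemma sym_psd_nonzero_diag:
  fixes A :: "real^'n^'n"
  assumes "sym_psd A" "A \<noteq> 0"
  obtains i where "A $ i $ i \<noteq> 0"
proof (rule ccontr)
  assume "\<not> thesis"
  with that have "\<And>i. A $ i $ i = 0" by blast
  then have "A $ j $ i = 0" for i j
    using sym_psd_diag_zero[OF assms(1), of i] matrix_vector_mult_axis_nth[of A i j] by simp
  then have "A = 0" by (simp add: vec_eq_iff)
  with assms(2) show False by simp
qed

definition outer :: "real^'n \<Rightarrow> real^'n^'n" where
  "outer c = (\<chi> i j. c $ i * c $ j)"

lemma outer_mult_vec: "outer c *v x = (c \<bullet> x) *\<^sub>R c"
  by (simp add: vec_eq_iff outer_def matrix_vector_mult_def inner_vec_def sum_distrib_left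
      sum_distrib_right mult_ac)

text \<open>Turns the pairing with a rank-one term into a value of the quadratic form of
  \<open>X\<close>, where positive definiteness applies.\<close>

lemma trace_inner_outer: "trace_inner X (outer c) = c \<bullet> (X *v c)"
  by (simp add: trace_inner_def trace_def outer_def matrix_matrix_mult_def matrix_vector_mult_def
      inner_vec_def sum_distrib_left mult_ac)

lemma linear_trace_inner: "linear (trace_inner X)"
  by (rule linearI)
    (simp_all add: trace_inner_def trace_add trace_def matrix_matrix_mult_def sum.distrib
      sum_distrib_left algebra_simps)

text \<open>One elimination step with pivot \<open>A $ i $ i\<close>, a Schur complement: the new
  form at \<open>x\<close> is the form of \<open>A\<close> at a shifted point
  \<open>x - s *\<^sub>R axis i 1\<close>, hence nonnegative.\<close>

lemma sym_psd_eliminate: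
  fixes A :: "real^'n^'n"
  assumes A: "sym_psd A" and nz: "A $ i $ i \<noteq> 0"
  shows "sym_psd (A - (1 / A $ i $ i) *\<^sub>R outer (A *v axis i 1))"
    (is "sym_psd ?A'")
  unfolding sym_psd_def
proof
  define b c where "b = A $ i $ i" and "c = A *v axis i 1"
  have b: "b > 0" using sym_psd_diag_pos[OF A nz] by (simp add: b_def)
  have sym: "symmetric_mat A" using A by (simp add: sym_psd_def)
  then show "symmetric_mat ?A'"
    by (simp add: symmetric_mat_iff outer_def mult_ac)
  show "\<forall>x. 0 \<le> x \<bullet> (?A' *v x)"
  proof
    fix x
    \<comment> \<open>This shift minimizes the form of \<open>A\<close> along the direction
      \<open>axis i 1\<close>.\<close>
    define s where "s = (c \<bullet> x) / b"
    have ax: "axis i 1 \<bullet> (A *v x) = c \<bullet> x"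
      using inner_symmetric_mat[OF sym, of "axis i 1" x] by (simp add: c_def)
    have aa: "axis i 1 \<bullet> c = b"
      by (simp add: c_def b_def inner_axis' matrix_vector_mult_axis_nth)
    have "0 \<le> (x - s *\<^sub>R axis i 1) \<bullet> (A *v (x - s *\<^sub>R axis i 1))"
      using A by (simp add: sym_psd_def)
    also have "\<dots> = x \<bullet> (A *v x) - 2 * s * (c \<bullet> x) + s * (s * b)"
      by (simp add: c_def[symmetric] matrix_vector_mult_diff_distrib matrix_vector_mult_scaleR
          inner_diff_left inner_diff_right ax aa inner_commute[of x c] algebra_simps)
    also have "\<dots> = x \<bullet> (A *v x) - (c \<bullet> x) * (c \<bullet> x) / b"
      using b by (simp add: s_def field_simps)
    also have "\<dots> = x \<bullet> (?A' *v x)"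
      by (simp add: matrix_vector_mult_diff_rdistrib scaleR_matrix_vector_assoc[symmetric]
          outer_mult_vec inner_diff_right b_def c_def inner_commute)
    finally show "0 \<le> x \<bullet> (?A' *v x)" .
  qed
qed

text \<open>Each elimination splits off a rank-one term that pairs positively with \<open>X\<close>
  and leaves a semidefinite remainder with fewer nonzero diagonal entries, so induction on their
  number applies.\<close>

lemma trace_inner_pos:
  fixes X A :: "real^'n^'n"
  assumes X: "sym_pd X" and "sym_psd A" "A \<noteq> 0"
  shows "trace_inner X A > 0"
  using assms(2,3)
proof (induction "card {j. A $ j $ j \<noteq> 0}" arbitrary: A rule: less_induct)
  case less
  obtain i where i: "A $ i $ i \<noteq> 0"
    using sym_psd_nonzero_diag less.prems by blast
  define b c where "b = A $ i $ i" and "c = A *v axis i 1"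
  define A' where "A' = A - (1 / b) *\<^sub>R outer c"
  have b: "b > 0" using sym_psd_diag_pos[OF less.prems(1) i] by (simp add: b_def)
  have c: "c $ j = A $ j $ i" for j
    by (simp add: c_def matrix_vector_mult_axis_nth)
  have c0: "c \<noteq> 0" using c[of i] i by auto
  have sym: "A $ j $ k = A $ k $ j" for j k
    using less.prems(1) by (simp add: sym_psd_def symmetric_mat_iff)
  have psd: "sym_psd A'"
    unfolding A'_def b_def c_def using sym_psd_eliminate[OF less.prems(1) i] .
  \<comment> \<open>Elimination creates no new nonzero diagonal entry: where the diagonal of
    \<open>A\<close> vanishes, so does the whole column, and with it the entry of
    \<open>c\<close>.\<close>
  have zero: "A' $ j $ j = 0" if "A $ j $ j = 0" for j
  proof -
    have "A $ i $ j = 0"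
      using sym_psd_diag_zero[OF less.prems(1) that] matrix_vector_mult_axis_nth[of A j i] by simp
    then have "c $ j = 0" using c sym by simp
    then show ?thesis using that by (simp add: A'_def outer_def)
  qed
  have "A' $ i $ i = 0"
    using b by (simp add: A'_def outer_def c b_def[symmetric])
  then have "{j. A' $ j $ j \<noteq> 0} \<subset> {j. A $ j $ j \<noteq> 0}"
    using zero i by auto
  then have "card {j. A' $ j $ j \<noteq> 0} < card {j. A $ j $ j \<noteq> 0}"
    by (intro psubset_card_mono) simp_all
  then have "A' \<noteq> 0 \<Longrightarrow> trace_inner X A' > 0"
    using less.hyps psd by blast
  \<comment> \<open>The remainder may be zero, so only a weak inequality is available; strictness
    comes from the rank-one term.\<close>
  then have "trace_inner X A' \<ge> 0"
    using linear_0[OF linear_trace_inner, of X] by (cases "A' = 0") auto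
  moreover have "trace_inner X A = trace_inner X A' + (1 / b) * (c \<bullet> (X *v c))"
    by (simp add: A'_def linear_diff[OF linear_trace_inner] linear_cmul[OF linear_trace_inner]
        trace_inner_outer)
  moreover have "c \<bullet> (X *v c) > 0"
    using X c0 by (simp add: sym_pd_def)
  ultimately show ?case using b by (simp add: add_nonneg_pos)
qed

lemma sum_trace_inner_resolution:
  assumes "(\<Sum>i\<in>I. B i) = mat 1"
  shows "(\<Sum>i\<in>I. trace_inner X (B i)) = trace X"
proof -
  have "trace_inner X (\<Sum>i\<in>I. B i) = trace X"
    by (simp add: assms trace_inner_def)
  then show ?thesis by (simp add: linear_sum[OF linear_trace_inner])
qed

text \<open>Reading the trace as a pairing with the identity lets the positivity and summation
  lemmas cover \<open>t\<close> as well as \<open>u\<close> and \<open>l\<close>.\<close>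

lemma trace_inner_mat_1: "trace_inner (mat 1) A = trace A"
  by (simp add: trace_inner_def)

theorem theorem6p2:
  fixes B :: "nat \<Rightarrow> real^'n^'n" and m :: nat
    and \<gamma> \<delta>\<^sub>U \<delta>\<^sub>L :: real
    and X\<^sub>L X\<^sub>U :: "real^'n^'n"
  assumes "\<And>i. i \<in> {1..m} \<Longrightarrow> sym_psd (B i)"
    and "\<And>i. i \<in> {1..m} \<Longrightarrow> B i \<noteq> 0"
    and "(\<Sum>i=1..m. B i) = mat 1"
    and "\<gamma> > 0" and "\<delta>\<^sub>U > 0" and "\<delta>\<^sub>L > 0"
    and "1 / \<delta>\<^sub>L - real CARD('n) \<ge> 1 / \<delta>\<^sub>U"
    and "sym_pd X\<^sub>L" and "sym_pd X\<^sub>U"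
    and "trace X\<^sub>L = 1" and "trace X\<^sub>U = 1"
  shows "\<exists>\<alpha>\<ge>0. \<exists>j\<in>{1..m}.
    \<delta>\<^sub>U \<ge> (exp (\<gamma> * \<alpha> * trace (B j)) - 1) / trace (B j) * trace_inner X\<^sub>U (B j) \<and>
    \<delta>\<^sub>L \<le> (1 - exp (- (\<gamma> * \<alpha> * trace (B j)))) / trace (B j) * trace_inner X\<^sub>L (B j)"
proof -
  define t u l where "t j = trace (B j)" and "u j = trace_inner X\<^sub>U (B j)"
    and "l j = trace_inner X\<^sub>L (B j)" for j
  have pd1: "sym_pd (mat 1 :: real^'n^'n)"
    by (simp add: sym_pd_def symmetric_mat_def)
  have tpos: "t j > 0" and upos: "u j > 0" if "j \<in> {1..m}" for j
    using trace_inner_pos[OF pd1, of "B j"] trace_inner_pos[OF assms(9), of "B j"]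
      assms(1,2)[OF that] by (simp_all add: t_def u_def trace_inner_mat_1)
  have st: "(\<Sum>j=1..m. t j) = real CARD('n)"
    using sum_trace_inner_resolution[OF assms(3), of "mat 1"]
    by (simp add: t_def trace_inner_mat_1 trace_I)
  have su: "(\<Sum>j=1..m. u j) = 1" and sl: "(\<Sum>j=1..m. l j) = 1"
    using sum_trace_inner_resolution[OF assms(3)] assms(10,11) by (simp_all add: u_def l_def)
  have "\<exists>j\<in>{1..m}. u j / \<delta>\<^sub>U + t j \<le> l j / \<delta>\<^sub>L"
  proof (rule ccontr)
    assume "\<not> ?thesis"
    then have less: "\<And>j. j \<in> {1..m} \<Longrightarrow> l j / \<delta>\<^sub>L < u j / \<delta>\<^sub>U + t j" by force
    \<comment> \<open>Strict inequality of the sums needs a nonempty index set; an empty one would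
      give the \<open>u j\<close> sum 0 instead of 1.\<close>
    have "{1..m} \<noteq> {}" using su by (metis sum.empty zero_neq_one)
    then have "(\<Sum>j=1..m. l j / \<delta>\<^sub>L) < (\<Sum>j=1..m. u j / \<delta>\<^sub>U + t j)"
      using less by (intro sum_strict_mono) simp_all
    also have "\<dots> = 1 / \<delta>\<^sub>U + real CARD('n)"
      using su st by (simp add: sum.distrib flip: sum_divide_distrib)
    also have "(\<Sum>j=1..m. l j / \<delta>\<^sub>L) = 1 / \<delta>\<^sub>L"
      using sl by (simp flip: sum_divide_distrib)
    finally show False using assms(7) by simp
  qed
  then obtain j where j: "j \<in> {1..m}" and ineq: "u j / \<delta>\<^sub>U + t j \<le> l j / \<delta>\<^sub>L" by blast
  note pos = tpos[OF j] upos[OF j] assms(4-6)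
  define r where "r = 1 + \<delta>\<^sub>U * t j / u j"
  define \<alpha> where "\<alpha> = ln r / (\<gamma> * t j)"
  have r: "r > 1" using pos by (simp add: r_def)
  then have "\<alpha> \<ge> 0" using pos by (simp add: \<alpha>_def)
  have e: "exp (\<gamma> * \<alpha> * t j) = r" using r pos by (simp add: \<alpha>_def)
  have "(r - 1) / t j * u j = \<delta>\<^sub>U" using pos by (simp add: r_def)
  moreover have "\<delta>\<^sub>L \<le> (1 - inverse r) / t j * l j"
  proof -
    \<comment> \<open>Since \<open>d = r * u j\<close>, the factor \<open>1 - inverse r\<close> is
      \<open>\<delta>\<^sub>U * t j / d\<close> and \<open>t j\<close> cancels. The claim becomes
      \<open>\<delta>\<^sub>L * d \<le> \<delta>\<^sub>U * l j\<close>, which is \<open>ineq\<close>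
      multiplied by \<open>\<delta>\<^sub>U * \<delta>\<^sub>L\<close>.\<close>
    define d where "d = u j + \<delta>\<^sub>U * t j"
    have d: "d > 0" using pos by (simp add: d_def add_pos_pos)
    have rd: "r = d / u j" using pos by (simp add: r_def d_def field_simps)
    have "1 - inverse r = (d - u j) / d" using d by (simp add: rd field_simps)
    then have "(1 - inverse r) / t j * l j = \<delta>\<^sub>U * l j / d"
      using pos by (simp add: d_def)
    moreover have "\<delta>\<^sub>L * d \<le> \<delta>\<^sub>U * l j"
      using ineq pos by (simp add: d_def field_simps)
    ultimately show ?thesis using d by (simp add: pos_le_divide_eq)
  qed
  ultimately have "\<delta>\<^sub>U \<ge> (exp (\<gamma> * \<alpha> * t j) - 1) / t j * u j \<and>
      \<delta>\<^sub>L \<le> (1 - exp (- (\<gamma> * \<alpha> * t j))) / t j * l j"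
    by (simp add: e exp_minus)
  then show ?thesis
    using \<open>\<alpha> \<ge> 0\<close> j unfolding t_def u_def l_def by blast
qed

end
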